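(* Let $\mathfrak X_n$ be a non-commutative rank 6 association scheme of order $n=3(m+1)$, $3\mid (m-1)$, with three thin relations $R_0,R_1,R_2$ and three thick relations $\Delta_0,\Delta_1,\Delta_2$ of valency $m$ satisfying the multiplication table given in the context. Choose any fiber as the island, and for $i\in\{0,1,2\}$ let $J_{n,i}$ be the rank 5 color graph obtained by the switching $Sw_i$. Then $J_{n,0}$, $J_{n,1}$, $J_{n,2}$ are combinatorially isomorphic proper rank 5 Jordan schemes.
   Context: Relations on a finite set are identified with their 0/1 adjacency matrices. An association scheme (AS) on a finite set $\Omega$ is a partition of $\Omega^2$ into nonempty relations, one of which is the identity relation, closed under transposition, whose adjacency matrices span a matrix algebra (closed under the usual product); it may be non-symmetric and non-commutative. Its rank is the number of relations. A Jordan scheme on $\Omega$ is a partition of $\Omega^2$ into nonempty symmetric relations, one of which is the identity relation, such that the real linear span of the adjacency matrices is closed under the Jordan product $A*B=\frac12(AB+BA)$. The symmetrization of an AS is obtained by replacing each relation $R$ by $R\cup R^T$. A Jordan scheme is non-proper if it is the symmetrization of some AS, and proper otherwise. Two color graphs are combinatorially isomorphic if some bijection of the vertex sets maps the set of relations of one onto the set of relations of the other. Setting: $\mathfrak X_n=(\Omega,\{R_0,R_1,R_2,\Delta_0,\Delta_1,\Delta_2\})$ with $|\Omega|=n=3(m+1)$, $m>1$, $3\mid(m-1)$, $R_0=\mathrm{Id}_\Omega$; the $R_i$ have valency 1 and the $\Delta_i$ have valency $m$; with indices modulo 3, $$R_iR_j=R_{i+j},\quad R_i\Delta_j=\Delta_{i+j},\quad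 \Delta_jR_i=\Delta_{j-i},\quad \Delta_i\Delta_j=mR_{i-j}+\tfrac{m-1}{3}(\Delta_0+\Delta_1+\Delta_2).$$ The relation $R_0\cup R_1\cup R_2$ is an equivalence relation with $m+1$ classes of size 3, called fibers. Fix one fiber, the island; the union of all other fibers is the continent. $T_i$ denotes the restriction of $\Delta_i$ to the continent, and the bridge $Br_i$ is the set of all pairs of $\Delta_i$ (in both directions) with one entry on the island and the other on the continent, so $\Delta_i=T_i\cup Br_i$. For $\{i,j,k\}=\{0,1,2\}$, the color graph $J_{n,i}$ has the five relations $\mathrm{Id}_n$, $R_1\cup R_2$, $\Delta_i$, $\Delta'_{i,j}=T_j\cup Br_k$, $\Delta'_{i,k}=T_k\cup Br_j$. *)

theory Defs
  imports "HOL-Analysis.Analysis"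
begin

text \<open>
  The finite vertex set is the universe of a finite type; a color graph on it is given by its
  set of basic relations, and its rank is the cardinality of that set.
\<close>

definition adjacency_matrix :: "'a::finite rel \<Rightarrow> real^'a^'a" where
  "adjacency_matrix S = (\<chi> x y. if (x, y) \<in> S then 1 else 0)"

definition association_scheme :: "'a::finite rel set \<Rightarrow> bool" where
  "association_scheme \<R> \<longleftrightarrow>
     partition_on UNIV \<R> \<and> Id \<in> \<R> \<and> (\<forall>S\<in>\<R>. S\<inverse> \<in> \<R>) \<and>
     (\<forall>A \<in> span (adjacency_matrix ` \<R>). \<forall>B \<in> span (adjacency_matrix ` \<R>).
        A ** B \<in> span (adjacency_matrix ` \<R>))"

definition commutative_scheme :: "'a::finite rel set \<Rightarrow> bool" where
  "commutative_scheme \<R> \<longleftrightarrow>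
     (\<forall>S\<in>\<R>. \<forall>T\<in>\<R>. adjacency_matrix S ** adjacency_matrix T
                        = adjacency_matrix T ** adjacency_matrix S)"

definition jordan_product :: "real^'a^'a \<Rightarrow> real^'a^'a \<Rightarrow> real^'a::finite^'a" where
  "jordan_product A B = (1/2) *\<^sub>R (A ** B + B ** A)"

definition jordan_scheme :: "'a::finite rel set \<Rightarrow> bool" where
  "jordan_scheme \<R> \<longleftrightarrow>
     partition_on UNIV \<R> \<and> Id \<in> \<R> \<and> (\<forall>S\<in>\<R>. sym S) \<and>
     (\<forall>A \<in> span (adjacency_matrix ` \<R>). \<forall>B \<in> span (adjacency_matrix ` \<R>).
        jordan_product A B \<in> span (adjacency_matrix ` \<R>))"

definition symmetrization :: "'a rel set \<Rightarrow> 'a rel set" where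
  "symmetrization \<R> = (\<lambda>S. S \<union> S\<inverse>) ` \<R>"

definition proper_jordan_scheme :: "'a::finite rel set \<Rightarrow> bool" where
  "proper_jordan_scheme \<R> \<longleftrightarrow>
     jordan_scheme \<R> \<and> \<not> (\<exists>\<A>. association_scheme \<A> \<and> \<R> = symmetrization \<A>)"

definition combinatorially_isomorphic :: "'a rel set \<Rightarrow> 'b rel set \<Rightarrow> bool" where
  "combinatorially_isomorphic \<R> \<S> \<longleftrightarrow>
     (\<exists>f :: 'a \<Rightarrow> 'b. bij f \<and> (\<lambda>S. map_prod f f ` S) ` \<R> = \<S>)"

definition has_valency :: "'a rel \<Rightarrow> nat \<Rightarrow> bool" where
  "has_valency S k \<longleftrightarrow> (\<forall>x. card (S `` {x}) = k)"

text \<open>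
  Indices are taken from the type \<^typ>\<open>3\<close>, whose ring operations are those of the integers
  modulo 3. Fibers are the classes of the union of the thin relations.
\<close>

definition fibers :: "(3 \<Rightarrow> 'a rel) \<Rightarrow> 'a set set" where
  "fibers R = UNIV // (R 0 \<union> R 1 \<union> R 2)"

definition continent_part :: "(3 \<Rightarrow> 'a rel) \<Rightarrow> 'a set \<Rightarrow> 3 \<Rightarrow> 'a rel" where
  "continent_part \<Delta> I i = {(x, y) \<in> \<Delta> i. x \<notin> I \<and> y \<notin> I}"

definition bridge :: "(3 \<Rightarrow> 'a rel) \<Rightarrow> 'a set \<Rightarrow> 3 \<Rightarrow> 'a rel" where
  "bridge \<Delta> I i = {(x, y) \<in> \<Delta> i. (x \<in> I \<and> y \<notin> I) \<or> (x \<notin> I \<and> y \<in> I)}"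

text \<open>The last set in the union has two members, one for each ordering of the indices other than \<open>i\<close>.\<close>

definition switched_graph ::
  "(3 \<Rightarrow> 'a rel) \<Rightarrow> (3 \<Rightarrow> 'a rel) \<Rightarrow> 'a set \<Rightarrow> 3 \<Rightarrow> 'a rel set" where
  "switched_graph R \<Delta> I i =
     {Id, R 1 \<union> R 2, \<Delta> i} \<union>
     {continent_part \<Delta> I j \<union> bridge \<Delta> I k | j k. {i, j, k} = {0, 1, 2}}"

end

theory Submission
  imports Defs
begin

text \<open>
  Write \<open>\<sigma>\<close> for the permutation with graph \<open>R 1\<close>; its powers \<open>\<sigma>\<^sup>t\<close> are the \<open>R t\<close>, and its orbits
  are the fibers. Two vertices in different fibers have a color, the index of the thick relation
  that contains them. The products \<open>R i \<Delta> j\<close> and the symmetry of \<open>\<Delta> j\<close> say that the color drops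
  by \<open>t\<close> when either end is moved by \<open>\<sigma>\<^sup>t\<close>. Switching at \<open>i\<close> applies the reflection \<open>c \<mapsto> 2i - c\<close> of
  the integers modulo 3, which fixes \<open>i\<close> and exchanges the other two colors, to the colors of the
  bridges. So the switched graph consists of \<open>Id\<close>, \<open>R 1 \<union> R 2\<close> and the three classes
  \<open>D p\<close> of the switched coloring.

  \<^bold>\<open>The Jordan product.\<close> The entries of \<open>D p D q\<close> count paths \<open>x, z, y\<close> with switched colors \<open>p\<close> and
  \<open>q\<close>. Symmetrized in \<open>p\<close> and \<open>q\<close>, these counts are the same as those for the \<open>\<Delta>\<close>
  (lemma \<open>switched_paths_symmetric_sum\<close>), and the latter are given by the product \<open>\<Delta> p \<Delta> q\<close>.
  If \<open>x\<close> and \<open>y\<close> lie on the island, both steps of every such path are reflected, so only the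
  sign of \<open>p - q\<close> changes. If just one of them lies on the island, one step is reflected, but the number \<open>(m - 1) / 3\<close> of
  \<open>\<Delta>\<close>-paths between different fibers does not depend on the colors. If both lie on the continent,
  only the paths through the island are reflected. Moving the middle vertex \<open>z\<close> along the island
  lowers both colors by the same amount, and this identifies the colors \<open>2i - p, 2i - q\<close> with
  \<open>q, p\<close>, so the reflected paths of type \<open>(p, q)\<close> are as many as the original ones of type
  \<open>(q, p)\<close>.

  \<^bold>\<open>Properness.\<close> The product \<open>D 1 D 0\<close>, not symmetrized, tells the island from the continent inside
  the fibers. From \<open>x\<close> to \<open>\<sigma> x\<close> and to \<open>\<sigma>\<^sup>2 x\<close> it has the entries \<open>0\<close> and \<open>m\<close> on the island, but
  \<open>m - 1\<close> and \<open>1\<close> on the continent (lemmas \<open>switched_product_on_island\<close> and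
  \<open>switched_product_on_continent\<close>). If the switched graph were the symmetrization of an association
  scheme, its adjacency matrices and hence \<open>D 1 D 0\<close> would lie in the algebra of that scheme.
  One relation \<open>S\<close> of the scheme would satisfy \<open>S \<union> S\<inverse> = R 1 \<union> R 2\<close>, so it would contain pairs
  from the island and pairs from the continent, and \<open>D 1 D 0\<close> would be constant on it. For \<open>m > 1\<close>
  the sets \<open>{0, m}\<close> and \<open>{m - 1, 1}\<close> are disjoint, so this is impossible.

  \<^bold>\<open>Isomorphism.\<close> Applying \<open>\<sigma>\<^sup>t\<close> to all vertices preserves the fibers, hence the island, and changes
  every color by \<open>-2t = t\<close>. So it carries the switching at \<open>i\<close> to the switching at \<open>i + t\<close>.
\<close>

section \<open>Spans of adjacency matrices\<close>

lemma adjacency_matrix_nth: "adjacency_matrix S $ x $ y = (if (x, y) \<in> S then 1 else 0)"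
  by (simp add: adjacency_matrix_def)

lemma adjacency_matrix_Id: "adjacency_matrix Id = mat 1"
  by (simp add: adjacency_matrix_def mat_def vec_eq_iff)

lemma adjacency_matrix_Un:
  "S \<inter> T = {} \<Longrightarrow> adjacency_matrix (S \<union> T) = adjacency_matrix S + adjacency_matrix T"
  by (auto simp: adjacency_matrix_nth vec_eq_iff)

lemma matrix_add_rdistrib: "(A + B) ** C = A ** C + B ** C"
  by (vector matrix_matrix_mult_def sum.distrib[symmetric] field_simps)

lemma adjacency_matrix_mult_nth:
  "(adjacency_matrix S ** adjacency_matrix T) $ x $ y
     = real (card {z. (x, z) \<in> S \<and> (z, y) \<in> T})"
proof -
  have "(adjacency_matrix S ** adjacency_matrix T) $ x $ y
      = (\<Sum>z\<in>UNIV. if (x, z) \<in> S \<and> (z, y) \<in> T then 1 else 0)"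
    by (auto simp: matrix_matrix_mult_def adjacency_matrix_nth intro!: sum.cong)
  then show ?thesis
    by (simp add: sum.If_cases)
qed

lemma adjacency_matrix_mult_transpose:
  assumes "sym S" "sym T"
  shows "(adjacency_matrix S ** adjacency_matrix T) $ x $ y
       = (adjacency_matrix T ** adjacency_matrix S) $ y $ x"
  unfolding adjacency_matrix_mult_nth
  by (rule arg_cong[of _ _ "\<lambda>A. real (card A)"]) (use assms in \<open>auto dest: symD\<close>)

text \<open>
  This gives the obstruction to being a symmetrization: a matrix in the algebra of a scheme
  cannot separate two pairs of one relation.
\<close>

lemma span_adjacency_const_on_classes:
  assumes "partition_on UNIV \<R>" "M \<in> span (adjacency_matrix ` \<R>)" "S \<in> \<R>"
    and "(x, y) \<in> S" "(x', y') \<in> S"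
  shows "M $ x $ y = M $ x' $ y'"
  using assms(2)
proof (induction rule: span_induct)
  case base
  show ?case
    by (auto simp: subspace_def)
next
  case (step A)
  then obtain T where T: "T \<in> \<R>" "A = adjacency_matrix T"
    by auto
  then have "T = S \<or> T \<inter> S = {}"
    using assms(1,3) by (auto simp: partition_on_def disjoint_def)
  then show ?case
    using T assms(4,5) by (auto simp: adjacency_matrix_nth)
qed

lemma span_adjacencyI:
  assumes part: "partition_on UNIV \<R>"
    and const: "\<And>S. S \<in> \<R> \<Longrightarrow> \<exists>c. \<forall>x y. (x, y) \<in> S \<longrightarrow> M $ x $ y = c"
  shows "M \<in> span (adjacency_matrix ` \<R>)"
proof -
  obtain c where c: "\<And>S x y. S \<in> \<R> \<Longrightarrow> (x, y) \<in> S \<Longrightarrow> M $ x $ y = c S"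
    using const by metis
  have "M $ x $ y = (\<Sum>S\<in>\<R>. c S *\<^sub>R adjacency_matrix S) $ x $ y" for x y
  proof -
    have "(x, y) \<in> \<Union>\<R>"
      using part by (simp add: partition_on_def)
    then obtain S where S: "S \<in> \<R>" "(x, y) \<in> S"
      by blast
    have other: "(x, y) \<notin> T" if "T \<in> \<R>" "T \<noteq> S" for T
      using part S that by (auto simp: partition_on_def disjoint_def)
    have entry: "(c T *\<^sub>R adjacency_matrix T) $ x $ y = (if T = S then c S else 0)" if "T \<in> \<R>" for T
      using S other that by (auto simp: adjacency_matrix_nth)
    have "(\<Sum>T\<in>\<R>. c T *\<^sub>R adjacency_matrix T) $ x $ y
        = (\<Sum>T\<in>\<R>. (c T *\<^sub>R adjacency_matrix T) $ x $ y)"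
      by simp
    also have "\<dots> = (\<Sum>T\<in>\<R>. if T = S then c S else 0)"
      by (rule sum.cong) (simp_all only: entry)
    also have "\<dots> = M $ x $ y"
      using S c by simp
    finally show ?thesis ..
  qed
  then have "M = (\<Sum>S\<in>\<R>. c S *\<^sub>R adjacency_matrix S)"
    by (simp add: vec_eq_iff)
  then show ?thesis
    by (simp only:) (intro span_sum span_scale span_base imageI)
qed

lemma jordan_product_commute: "jordan_product A B = jordan_product B A"
  by (simp add: jordan_product_def add.commute)

lemma jordan_product_linear_left: "linear (\<lambda>A. jordan_product A B)"
proof -
  have "linear (\<lambda>A. A ** B)" "linear (\<lambda>A. B ** A)"
    by (auto intro!: linearI simp: matrix_matrix_mult_def vec_eq_iff sum.distrib
        algebra_simps sum_distrib_left)
  then show ?thesis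
    unfolding jordan_product_def by (intro linear_compose_scale_right linear_compose_add)
qed

text \<open>
  The Jordan product is bilinear, so closure of a span need only be tested on the spanning
  matrices.
\<close>

lemma jordan_product_span_closed:
  assumes "\<And>A B. A \<in> G \<Longrightarrow> B \<in> G \<Longrightarrow> jordan_product A B \<in> span G"
    and "A \<in> span G" "B \<in> span G"
  shows "jordan_product A B \<in> span G"
proof -
  have subspace: "subspace {A. jordan_product A B \<in> span G}" for B
    using linear_subspace_vimage[OF jordan_product_linear_left subspace_span]
    by (simp add: vimage_def)
  have "jordan_product A B \<in> span G" if "B \<in> G" for B
    using assms(2) by (rule span_induct) (use subspace assms(1) that in auto)
  then have "jordan_product B A \<in> span G" if "B \<in> G" for B
    using that by (subst jordan_product_commute)
  then have "jordan_product B A \<in> span G"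
    using span_induct[OF assms(3), of "\<lambda>B. jordan_product B A \<in> span G"] subspace by auto
  then show ?thesis
    by (subst jordan_product_commute)
qed

lemma partition_on_class_map:
  assumes "\<And>z. cls z \<in> \<R>" "\<And>z. z \<in> cls z" "\<And>S z. S \<in> \<R> \<Longrightarrow> z \<in> S \<Longrightarrow> S = cls z" "{} \<notin> \<R>"
  shows "partition_on UNIV \<R>"
  unfolding partition_on_def disjoint_def using assms by blast

text \<open>
  A relation and its converse in a scheme are equal or disjoint. So the matrix of the
  symmetrized relation is either the matrix of the relation or the sum of two such matrices.
\<close>

lemma symmetrization_in_span:
  assumes "association_scheme \<A>" "S \<in> symmetrization \<A>"
  shows "adjacency_matrix S \<in> span (adjacency_matrix ` \<A>)"
proof -
  obtain T where T: "T \<in> \<A>" "S = T \<union> T\<inverse>"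
    using assms(2) by (auto simp: symmetrization_def)
  have T': "T\<inverse> \<in> \<A>"
    using assms(1) T(1) by (simp add: association_scheme_def)
  show ?thesis
  proof (cases "T = T\<inverse>")
    case True
    then have "S = T"
      using T(2) by simp
    then show ?thesis
      using T(1) by (simp add: span_base)
  next
    case False
    then have "T \<inter> T\<inverse> = {}"
      using assms(1) T(1) T' by (auto simp: association_scheme_def partition_on_def disjoint_def)
    then show ?thesis
      using T T' by (simp add: adjacency_matrix_Un span_add span_base)
  qed
qed

section \<open>Residues modulo 3\<close>

lemma exhaust_Z3: "(i::3) = 0 \<or> i = 1 \<or> i = 2"
proof -
  have "(3::3) = 0" by simp
  then show ?thesis using exhaust_3[of i] by metis
qed

text \<open>
  The two colors other than \<open>i\<close> are exchanged by the reflection at \<open>i\<close>.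
\<close>

lemma Z3_complement: "{i, j, k} = {0, 1, 2::3} \<longleftrightarrow> j \<noteq> i \<and> k = 2 * i - j"
proof -
  have "{i, j, k} = {0, 1, 2} \<longleftrightarrow> 0 \<in> {i, j, k} \<and> 1 \<in> {i, j, k} \<and> 2 \<in> {i, j, k}"
    using exhaust_Z3 by blast
  then show ?thesis
    using exhaust_Z3[of i] exhaust_Z3[of j] exhaust_Z3[of k]
    by (elim disjE) simp_all
qed

text \<open>
  For \<open>p \<noteq> q\<close> the differences \<open>p - q\<close> and \<open>q - p\<close> are the two nonzero residues, so exactly one
  of them is \<open>t\<close>. For this reason symmetrized path counts do not separate \<open>R 1\<close> from \<open>R 2\<close>.
\<close>

lemma Z3_opposite_differences:
  fixes p q t :: 3
  assumes "p \<noteq> q" "t \<noteq> 0"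
  shows "q - p = t \<longleftrightarrow> p - q \<noteq> t"
  using exhaust_Z3[of p] exhaust_Z3[of q] exhaust_Z3[of t] assms
  by (elim disjE) simp_all

section \<open>Colors and shifts in the association scheme\<close>

locale cyclic_scheme =
  fixes m :: nat
    and R \<Delta> :: "3 \<Rightarrow> 'a::finite rel"
  assumes m_gt_1: "m > 1"
    and partition: "partition_on UNIV (range R \<union> range \<Delta>)"
    and rank: "card (range R \<union> range \<Delta>) = 6"
    and R_0: "R 0 = Id"
    and valency_R: "\<And>i. has_valency (R i) 1"
    and valency_\<Delta>: "\<And>i. has_valency (\<Delta> i) m"
    and mult_R_R: "\<And>i j. adjacency_matrix (R i) ** adjacency_matrix (R j) = adjacency_matrix (R (i + j))"
    and mult_R_\<Delta>: "\<And>i j. adjacency_matrix (R i) ** adjacency_matrix (\<Delta> j) = adjacency_matrix (\<Delta> (i + j))"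
    and mult_\<Delta>_\<Delta>: "\<And>i j. adjacency_matrix (\<Delta> i) ** adjacency_matrix (\<Delta> j) =
           real m *\<^sub>R adjacency_matrix (R (i - j)) +
           ((real m - 1) / 3) *\<^sub>R
             (adjacency_matrix (\<Delta> 0) + adjacency_matrix (\<Delta> 1) + adjacency_matrix (\<Delta> 2))"
begin

definition shift :: "3 \<Rightarrow> 'a \<Rightarrow> 'a" where
  "shift t x = (THE y. (x, y) \<in> R t)"

definition same_fiber :: "'a \<Rightarrow> 'a \<Rightarrow> bool" where
  "same_fiber x y \<longleftrightarrow> (\<exists>t. y = shift t x)"

text \<open>
  Only the colors of pairs in different fibers have a meaning; for the others the description
  denotes nothing definite.
\<close>

definition color :: "'a \<Rightarrow> 'a \<Rightarrow> 3" where
  "color x y = (THE i. (x, y) \<in> \<Delta> i)"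

lemma R_iff: "(x, y) \<in> R t \<longleftrightarrow> y = shift t x"
proof -
  have "card (R t `` {x}) = 1"
    using valency_R by (simp add: has_valency_def)
  then obtain z where z: "R t `` {x} = {z}"
    by (rule card_1_singletonE)
  then have iff: "(x, y) \<in> R t \<longleftrightarrow> y = z" for y
    by auto
  then show ?thesis
    by (simp add: shift_def)
qed

lemma R_mult_nth:
  "(adjacency_matrix (R t) ** adjacency_matrix S) $ x $ y = adjacency_matrix S $ shift t x $ y"
proof -
  have "{z. (x, z) \<in> R t \<and> (z, y) \<in> S} = (if (shift t x, y) \<in> S then {shift t x} else {})"
    by (auto simp: R_iff)
  then show ?thesis
    by (simp add: adjacency_matrix_mult_nth adjacency_matrix_nth)
qed

lemma shift_0: "shift 0 x = x"
  using R_iff[of x x 0] by (simp add: R_0)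

lemma shift_shift: "shift t (shift s x) = shift (s + t) x"
proof -
  have "adjacency_matrix (R t) $ shift s x $ y = adjacency_matrix (R (s + t)) $ x $ y" for y
    using R_mult_nth[of s "R t"] by (simp add: mult_R_R)
  from this[of "shift t (shift s x)"] show ?thesis
    by (simp add: adjacency_matrix_nth R_iff split: if_splits)
qed

lemma \<Delta>_shift: "(shift t x, y) \<in> \<Delta> i \<longleftrightarrow> (x, y) \<in> \<Delta> (t + i)"
  using R_mult_nth[of t "\<Delta> i" x y] by (simp add: mult_R_\<Delta> adjacency_matrix_nth split: if_splits)

text \<open>
  Both families have three indices, so six relations in all leave no room for a coincidence.
\<close>

lemma distinct_relations: "inj R" "inj \<Delta>" "range R \<inter> range \<Delta> = {}"
proof -
  have le: "card (range R) \<le> 3" "card (range \<Delta>) \<le> 3"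
    using card_image_le[of "UNIV :: 3 set" R] card_image_le[of "UNIV :: 3 set" \<Delta>] by simp_all
  have "card (range R) + card (range \<Delta>) = 6 + card (range R \<inter> range \<Delta>)"
    using card_Un_Int[of "range R" "range \<Delta>"] rank by simp
  with le have eqs: "card (range R) = 3" "card (range \<Delta>) = 3" "card (range R \<inter> range \<Delta>) = 0"
    by linarith+
  show "inj R" "inj \<Delta>"
    using eqs by (simp_all add: eq_card_imp_inj_on)
  show "range R \<inter> range \<Delta> = {}"
    using eqs(3) by simp
qed

lemma relation_unique:
  assumes "S \<in> range R \<union> range \<Delta>" "T \<in> range R \<union> range \<Delta>" "z \<in> S" "z \<in> T"
  shows "S = T"
  using partition assms unfolding partition_on_def disjoint_def by blast

lemma shift_inj_index: "shift s x = shift t x \<longleftrightarrow> s = t"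
  using relation_unique[of "R s" "R t" "(x, shift s x)"] distinct_relations(1)
  by (auto simp: R_iff dest: injD)

lemma \<Delta>_iff: "(x, y) \<in> \<Delta> i \<longleftrightarrow> \<not> same_fiber x y \<and> color x y = i"
proof (cases "same_fiber x y")
  case True
  then obtain t where "(x, y) \<in> R t"
    by (auto simp: same_fiber_def R_iff)
  then have "(x, y) \<notin> \<Delta> i"
    using relation_unique[of "R t" "\<Delta> i" "(x, y)"] distinct_relations(3) by blast
  then show ?thesis
    using True by simp
next
  case False
  have "(x, y) \<in> \<Union> (range R \<union> range \<Delta>)"
    using partition by (simp add: partition_on_def)
  then obtain j where j: "(x, y) \<in> \<Delta> j"
    using False by (auto simp: same_fiber_def R_iff)
  have unique: "k = j" if "(x, y) \<in> \<Delta> k" for k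
    using relation_unique[of "\<Delta> j" "\<Delta> k" "(x, y)"] j that distinct_relations(2)
    by (auto dest: injD)
  have "color x y = j"
    unfolding color_def by (rule the_equality) (rule j, rule unique)
  then show ?thesis
    using False j unique by metis
qed

lemma same_fiber_refl: "same_fiber x x"
  unfolding same_fiber_def by (rule exI[of _ 0]) (simp add: shift_0)

lemma same_fiber_sym: "same_fiber x y \<Longrightarrow> same_fiber y x"
  unfolding same_fiber_def
proof (elim exE)
  fix t assume "y = shift t x"
  then have "x = shift (- t) y"
    by (simp add: shift_shift shift_0)
  then show "\<exists>t. x = shift t y" ..
qed

lemma same_fiber_trans: "same_fiber x y \<Longrightarrow> same_fiber y z \<Longrightarrow> same_fiber x z"
  unfolding same_fiber_def by (auto simp: shift_shift)

lemma same_fiber_commute: "same_fiber x y \<longleftrightarrow> same_fiber y x"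
  using same_fiber_sym by blast

lemma same_fiber_shift: "same_fiber x (shift t x)"
  by (auto simp: same_fiber_def)

lemma same_fiber_shift_iff [simp]:
  "same_fiber (shift t x) y \<longleftrightarrow> same_fiber x y" "same_fiber x (shift t y) \<longleftrightarrow> same_fiber x y"
  using same_fiber_shift same_fiber_sym same_fiber_trans by blast+

lemma same_fiber_iff_R: "same_fiber x y \<longleftrightarrow> x = y \<or> (x, y) \<in> R 1 \<union> R 2"
proof
  assume "same_fiber x y"
  then obtain t where "y = shift t x"
    by (auto simp: same_fiber_def)
  then show "x = y \<or> (x, y) \<in> R 1 \<union> R 2"
    using exhaust_Z3[of t] by (auto simp: R_iff shift_0)
qed (auto simp: R_iff same_fiber_refl same_fiber_shift)

lemma R_1_2_iff: "(x, y) \<in> R 1 \<union> R 2 \<longleftrightarrow> same_fiber x y \<and> x \<noteq> y"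
proof -
  have "(x, x) \<notin> R t" if "t \<noteq> 0" for t
    using shift_inj_index[of 0 x t] that by (simp add: R_iff shift_0)
  then have "(x, x) \<notin> R 1 \<union> R 2"
    by simp
  then show ?thesis
    using same_fiber_iff_R[of x y] by auto
qed

lemma sym_R_1_2: "sym (R 1 \<union> R 2)"
  by (rule symI) (use R_1_2_iff same_fiber_sym in blast)

lemma count_\<Delta>_paths:
  "real (card {z. (x, z) \<in> \<Delta> i \<and> (z, y) \<in> \<Delta> j})
     = (if same_fiber x y then (if y = shift (i - j) x then real m else 0) else (real m - 1) / 3)"
proof -
  have "adjacency_matrix (\<Delta> 0) $ x $ y + adjacency_matrix (\<Delta> 1) $ x $ y + adjacency_matrix (\<Delta> 2) $ x $ y
      = (if same_fiber x y then 0 else 1)"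
    using exhaust_Z3[of "color x y"] by (elim disjE) (simp_all add: adjacency_matrix_nth \<Delta>_iff)
  moreover have "adjacency_matrix (R (i - j)) $ x $ y = 0" if "\<not> same_fiber x y"
    using that same_fiber_shift by (auto simp: adjacency_matrix_nth R_iff)
  ultimately show ?thesis
    unfolding adjacency_matrix_mult_nth[symmetric]
    by (auto simp: mult_\<Delta>_\<Delta> R_iff adjacency_matrix_nth)
qed

text \<open>
  The diagonal entry of \<open>\<Delta> i \<Delta> i\<close> at \<open>x\<close> is \<open>m\<close>, the number of all successors of \<open>x\<close>, so
  every successor of \<open>x\<close> is also a predecessor.
\<close>

lemma \<Delta>_sym:
  assumes "(x, y) \<in> \<Delta> i"
  shows "(y, x) \<in> \<Delta> i"
proof -
  have "card {z. (x, z) \<in> \<Delta> i \<and> (z, x) \<in> \<Delta> i} = card (\<Delta> i `` {x})"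
    using count_\<Delta>_paths[of x i x i] valency_\<Delta>
    by (simp add: same_fiber_refl shift_0 has_valency_def)
  then have "{z. (x, z) \<in> \<Delta> i \<and> (z, x) \<in> \<Delta> i} = \<Delta> i `` {x}"
    by (intro card_subset_eq) auto
  then show ?thesis
    using assms by auto
qed

lemma color_sym: "color x y = color y x"
proof (cases "same_fiber x y")
  case True
  then have "(x, y) \<notin> \<Delta> i" "(y, x) \<notin> \<Delta> i" for i
    using \<Delta>_iff same_fiber_sym by blast+
  then show ?thesis
    by (simp add: color_def)
next
  case False
  then show ?thesis
    using \<Delta>_iff \<Delta>_sym by blast
qed

lemma color_shift_left:
  assumes "\<not> same_fiber x y"
  shows "color (shift t x) y = color x y - t"
proof -
  have "(shift t x, y) \<in> \<Delta> (color x y - t)"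
    unfolding \<Delta>_shift using assms by (simp add: \<Delta>_iff)
  then show ?thesis
    using \<Delta>_iff by blast
qed

lemma color_shift_right:
  assumes "\<not> same_fiber x y"
  shows "color x (shift t y) = color x y - t"
  using color_shift_left[of y x t] assms same_fiber_sym color_sym by metis

end

section \<open>The switched graph as a recoloring\<close>

locale switching = cyclic_scheme +
  fixes island :: "'a::finite set"
  assumes island_fiber: "island \<in> fibers R"
begin

lemma island_cases:
  obtains x where "x \<in> island" "\<And>y. y \<in> island \<longleftrightarrow> same_fiber x y"
proof -
  obtain x where x: "island = (R 0 \<union> R 1 \<union> R 2) `` {x}"
    using island_fiber by (auto simp: fibers_def elim: quotientE)
  then have "y \<in> island \<longleftrightarrow> same_fiber x y" for y
    using same_fiber_iff_R[of x y] by (auto simp: R_0)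
  then show ?thesis
    using that same_fiber_refl by blast
qed

lemma island_same_fiber:
  "same_fiber x y \<Longrightarrow> x \<in> island \<longleftrightarrow> y \<in> island"
  "x \<in> island \<Longrightarrow> y \<in> island \<Longrightarrow> same_fiber x y"
  by (rule island_cases, use same_fiber_trans same_fiber_sym in blast)+

lemma shift_island [simp]: "shift t x \<in> island \<longleftrightarrow> x \<in> island"
  using island_same_fiber(1) same_fiber_shift by blast

lemma continent_nonempty: obtains x where "x \<notin> island"
proof -
  obtain x where x: "x \<in> island"
    by (rule island_cases)
  have "card (\<Delta> 0 `` {x}) > 0"
    using valency_\<Delta> m_gt_1 by (simp add: has_valency_def)
  then obtain y where "(x, y) \<in> \<Delta> 0"
    by (auto simp: card_gt_0_iff)
  then have "y \<notin> island"
    using x island_same_fiber(2) by (auto simp: \<Delta>_iff)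
  then show ?thesis
    by (rule that)
qed

text \<open>
  The map \<open>c \<mapsto> 2 * i - c\<close> is the transposition of the colors other than \<open>i\<close>. It is written
  arithmetically so that its interplay with the shifts is a matter of sign.
\<close>

definition switched_color :: "3 \<Rightarrow> 'a \<Rightarrow> 'a \<Rightarrow> 3" where
  "switched_color i x y = (if x \<in> island \<longleftrightarrow> y \<in> island then color x y else 2 * i - color x y)"

definition switched_rel :: "3 \<Rightarrow> 3 \<Rightarrow> 'a rel" where
  "switched_rel i p = {(x, y). \<not> same_fiber x y \<and> switched_color i x y = p}"

lemma switched_rel_iff: "(x, y) \<in> switched_rel i p \<longleftrightarrow> \<not> same_fiber x y \<and> switched_color i x y = p"
  by (simp add: switched_rel_def)

lemma switched_color_sym: "switched_color i x y = switched_color i y x"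
  by (auto simp: switched_color_def color_sym)

lemma sym_switched_rel: "sym (switched_rel i p)"
  by (rule symI) (metis switched_rel_iff switched_color_sym same_fiber_commute)

lemma switched_color_shift_left:
  assumes "\<not> same_fiber x y"
  shows "switched_color i (shift t x) y
       = (if x \<in> island \<longleftrightarrow> y \<in> island then switched_color i x y - t else switched_color i x y + t)"
  using assms by (simp add: switched_color_def color_shift_left)

lemma switched_graph_eq:
  "switched_graph R \<Delta> island i = {Id, R 1 \<union> R 2} \<union> range (switched_rel i)"
proof -
  have switched: "continent_part \<Delta> island j \<union> bridge \<Delta> island (2 * i - j) = switched_rel i j" for j
  proof -
    have "(x, y) \<in> continent_part \<Delta> island j \<union> bridge \<Delta> island (2 * i - j)
        \<longleftrightarrow> (x, y) \<in> switched_rel i j" for x y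
    proof -
      have "2 * i - color x y = j \<longleftrightarrow> color x y = 2 * i - j"
        by (auto simp: algebra_simps)
      then show ?thesis
        using island_same_fiber(2)[of x y]
        by (cases "x \<in> island"; cases "y \<in> island")
          (simp_all add: continent_part_def bridge_def \<Delta>_iff switched_rel_iff switched_color_def)
    qed
    then show ?thesis
      by (intro set_eqI) (simp only: split_paired_all)
  qed
  have unswitched: "switched_rel i i = \<Delta> i"
  proof -
    have "(x, y) \<in> switched_rel i i \<longleftrightarrow> (x, y) \<in> \<Delta> i" for x y
    proof -
      have "2 * i - color x y = i \<longleftrightarrow> color x y = i"
        by (auto simp: algebra_simps)
      then show ?thesis
        by (simp add: \<Delta>_iff switched_rel_iff switched_color_def)
    qed
    then show ?thesis
      by (intro set_eqI) (simp only: split_paired_all)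
  qed
  have "{continent_part \<Delta> island j \<union> bridge \<Delta> island k | j k. {i, j, k} = {0, 1, 2}}
      = {switched_rel i j | j. j \<noteq> i}"
    using switched by (auto simp: Z3_complement)
  then show ?thesis
    unfolding switched_graph_def unswitched[symmetric] by auto
qed

text \<open>
  A shift acts on the switched color as a translation, in one direction or the other, so along a
  fiber every color occurs.
\<close>

lemma switched_rel_meets_fibers:
  assumes "\<not> same_fiber x y"
  shows "\<exists>t. (shift t x, y) \<in> switched_rel i p"
proof (cases "x \<in> island \<longleftrightarrow> y \<in> island")
  case True
  then show ?thesis
    using assms by (intro exI[of _ "switched_color i x y - p"])
      (simp add: switched_rel_iff switched_color_shift_left)
next
  case False
  then show ?thesis
    using assms by (intro exI[of _ "p - switched_color i x y"])
      (simp add: switched_rel_iff switched_color_shift_left)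
qed

lemma switched_rel_nonempty: "switched_rel i p \<noteq> {}"
proof -
  obtain x y where "x \<in> island" "y \<notin> island"
    by (metis island_cases continent_nonempty)
  then have "\<not> same_fiber x y"
    using island_same_fiber(1) by blast
  then show ?thesis
    using switched_rel_meets_fibers by blast
qed

lemma R_1_2_nonempty: "R 1 \<union> R 2 \<noteq> {}"
  using R_iff by blast

section \<open>Partition and rank\<close>

lemma partition_switched_graph: "partition_on UNIV (switched_graph R \<Delta> island i)"
proof (rule partition_on_class_map)
  define cls where "cls = (\<lambda>(x, y). if x = y then Id else if same_fiber x y then R 1 \<union> R 2
    else switched_rel i (switched_color i x y))"
  show "cls z \<in> switched_graph R \<Delta> island i" "z \<in> cls z" for z
    using R_1_2_iff by (auto simp: cls_def switched_graph_eq switched_rel_iff split: prod.splits)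
  show "S = cls z" if S: "S \<in> switched_graph R \<Delta> island i" and in_S: "z \<in> S" for S z
  proof -
    obtain x y where z: "z = (x, y)"
      by (cases z)
    consider "S = Id" | "S = R 1 \<union> R 2" | p where "S = switched_rel i p"
      using S unfolding switched_graph_eq by blast
    then show ?thesis
    proof cases
      case 1
      then show ?thesis using in_S by (auto simp: z cls_def)
    next
      case 2
      then show ?thesis using in_S R_1_2_iff[of x y] by (auto simp: z cls_def)
    next
      case 3
      then show ?thesis
        using in_S same_fiber_refl by (auto simp: z cls_def switched_rel_iff)
    qed
  qed
  show "{} \<notin> switched_graph R \<Delta> island i"
    using switched_rel_nonempty R_1_2_nonempty by (auto simp: switched_graph_eq)
qed

lemma card_switched_graph: "card (switched_graph R \<Delta> island i) = 5"
proof -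
  have "inj (switched_rel i)"
  proof (rule injI)
    fix p q assume eq: "switched_rel i p = switched_rel i q"
    obtain x y where "(x, y) \<in> switched_rel i p"
      using switched_rel_nonempty by fastforce
    then show "p = q"
      using eq by (metis switched_rel_iff)
  qed
  then have "card (range (switched_rel i)) = 3"
    by (simp add: card_image)
  moreover have "Id \<noteq> R 1 \<union> R 2"
    using R_1_2_iff same_fiber_refl R_1_2_nonempty by fast
  moreover have "{Id, R 1 \<union> R 2} \<inter> range (switched_rel i) = {}"
  proof -
    have "Id \<noteq> switched_rel i p" "R 1 \<union> R 2 \<noteq> switched_rel i p" for p
    proof -
      obtain x y where xy: "(x, y) \<in> switched_rel i p"
        using switched_rel_nonempty by fastforce
      then have "\<not> same_fiber x y"
        by (simp add: switched_rel_iff)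
      then have "(x, y) \<notin> Id" "(x, y) \<notin> R 1 \<union> R 2"
        using same_fiber_refl R_1_2_iff by blast+
      then show "Id \<noteq> switched_rel i p" "R 1 \<union> R 2 \<noteq> switched_rel i p"
        using xy by metis+
    qed
    then show ?thesis
      by auto
  qed
  ultimately show ?thesis
    unfolding switched_graph_eq by (subst card_Un_disjoint) auto
qed

section \<open>Path counts for the switched coloring\<close>

lemma adjacency_R_1_2: "adjacency_matrix (R 1 \<union> R 2) = adjacency_matrix (R 1) + adjacency_matrix (R 2)"
  using shift_inj_index[of 1 _ 2] by (intro adjacency_matrix_Un) (auto simp: R_iff)

text \<open>
  Middle vertices of the paths of color type \<open>(p, q)\<close> from \<open>x\<close> to \<open>y\<close>. The set \<open>Z\<close> serves to
  separate the paths through the island from the others.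
\<close>

definition paths :: "('a \<Rightarrow> 'a \<Rightarrow> 3) \<Rightarrow> 'a set \<Rightarrow> 3 \<Rightarrow> 3 \<Rightarrow> 'a \<Rightarrow> 'a \<Rightarrow> 'a set" where
  "paths \<kappa> Z p q x y =
     {z \<in> Z. \<not> same_fiber x z \<and> \<not> same_fiber z y \<and> \<kappa> x z = p \<and> \<kappa> z y = q}"

lemma card_paths_split:
  "card (paths \<kappa> UNIV p q x y) = card (paths \<kappa> island p q x y) + card (paths \<kappa> (- island) p q x y)"
proof -
  have "paths \<kappa> UNIV p q x y = paths \<kappa> island p q x y \<union> paths \<kappa> (- island) p q x y"
    by (auto simp: paths_def)
  then show ?thesis
    by (simp add: card_Un_disjoint paths_def disjoint_iff)
qed

lemma switched_mult_nth:
  "(adjacency_matrix (switched_rel i p) ** adjacency_matrix (switched_rel i q)) $ x $ y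
     = real (card (paths (switched_color i) UNIV p q x y))"
  unfolding adjacency_matrix_mult_nth
  by (rule arg_cong[of _ _ "\<lambda>A. real (card A)"]) (auto simp: switched_rel_iff paths_def)

lemma card_paths_color:
  "real (card (paths color UNIV p q x y))
     = (if same_fiber x y then (if y = shift (p - q) x then real m else 0) else (real m - 1) / 3)"
proof -
  have "paths color UNIV p q x y = {z. (x, z) \<in> \<Delta> p \<and> (z, y) \<in> \<Delta> q}"
    by (auto simp: paths_def \<Delta>_iff)
  then show ?thesis
    by (simp add: count_\<Delta>_paths)
qed

text \<open>
  Moving the middle vertex by a shift lowers both colors of the path by the same amount and
  stays on the island.
\<close>

lemma card_island_paths_shift:
  assumes "x \<notin> island" "y \<notin> island"
  shows "card (paths color island (p - t) (q - t) x y) = card (paths color island p q x y)"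
proof -
  have sep: "\<not> same_fiber x z" "\<not> same_fiber z y" if "z \<in> island" for z
    using assms that island_same_fiber(1) by blast+
  have "bij_betw (shift t) (paths color island p q x y) (paths color island (p - t) (q - t) x y)"
    by (rule bij_betw_byWitness[of _ "shift (- t)"])
      (auto simp: paths_def shift_shift shift_0 color_shift_left color_shift_right sep)
  then show ?thesis
    by (simp add: bij_betw_same_card)
qed

text \<open>
  The middle vertex lies on the continent, since vertices of one fiber have no color. So both
  steps cross a bridge.
\<close>

lemma switched_paths_island:
  assumes "x \<in> island" "y \<in> island"
  shows "paths (switched_color i) UNIV p q x y = paths color UNIV (2 * i - p) (2 * i - q) x y"
proof -
  have "z \<in> paths (switched_color i) UNIV p q x y \<longleftrightarrow> z \<in> paths color UNIV (2 * i - p) (2 * i - q) x y" for z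
  proof (cases "z \<in> island")
    case True
    then show ?thesis
      using assms island_same_fiber(2) by (auto simp: paths_def)
  next
    case False
    have "2 * i - color x z = p \<longleftrightarrow> color x z = 2 * i - p"
      "2 * i - color z y = q \<longleftrightarrow> color z y = 2 * i - q"
      by (auto simp: algebra_simps)
    then show ?thesis
      using assms False by (simp add: paths_def switched_color_def)
  qed
  then show ?thesis
    by blast
qed

text \<open>
  Again the middle vertex lies on the continent, but here only the second step crosses a bridge.
\<close>

lemma switched_paths_mixed:
  assumes "x \<notin> island" "y \<in> island"
  shows "paths (switched_color i) UNIV p q x y = paths color UNIV p (2 * i - q) x y"
proof -
  have "z \<in> paths (switched_color i) UNIV p q x y \<longleftrightarrow> z \<in> paths color UNIV p (2 * i - q) x y" for z
  proof (cases "z \<in> island")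
    case True
    then show ?thesis
      using assms island_same_fiber(2) by (auto simp: paths_def)
  next
    case False
    have "2 * i - color z y = q \<longleftrightarrow> color z y = 2 * i - q"
      by (auto simp: algebra_simps)
    then show ?thesis
      using assms False by (simp add: paths_def switched_color_def)
  qed
  then show ?thesis
    by blast
qed

text \<open>
  Paths within the continent keep their colors. A path through the island has both steps
  reflected, to the type \<open>(2 * i - p, 2 * i - q)\<close>; this differs from \<open>(q, p)\<close> by the same amount
  \<open>p + q - 2 * i\<close> in both places, so a shift of the middle vertex turns one into the other.
\<close>

lemma card_switched_paths_continent:
  assumes "x \<notin> island" "y \<notin> island"
  shows "card (paths (switched_color i) UNIV p q x y)
       = card (paths color (- island) p q x y) + card (paths color island q p x y)"
proof -
  have "paths (switched_color i) (- island) p q x y = paths color (- island) p q x y"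
    using assms by (auto simp: paths_def switched_color_def)
  moreover have "paths (switched_color i) island p q x y = paths color island (2 * i - p) (2 * i - q) x y"
  proof -
    have "2 * i - color x z = p \<longleftrightarrow> color x z = 2 * i - p"
      "2 * i - color z y = q \<longleftrightarrow> color z y = 2 * i - q" for z
      by (auto simp: algebra_simps)
    then show ?thesis
      using assms by (auto simp: paths_def switched_color_def)
  qed
  moreover have "card (paths color island (2 * i - p) (2 * i - q) x y)
      = card (paths color island q p x y)"
    using card_island_paths_shift[OF assms, of q "p + q - 2 * i" p] by (simp add: algebra_simps)
  ultimately show ?thesis
    by (simp add: card_paths_split)
qed

lemma switched_mult_transpose:
  "(adjacency_matrix (switched_rel i p) ** adjacency_matrix (switched_rel i q)) $ x $ y
     = (adjacency_matrix (switched_rel i q) ** adjacency_matrix (switched_rel i p)) $ y $ x"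
  by (rule adjacency_matrix_mult_transpose) (rule sym_switched_rel)+

lemma card_switched_paths_reverse:
  "card (paths (switched_color i) UNIV p q x y) = card (paths (switched_color i) UNIV q p y x)"
  using switched_mult_transpose[of i p q x y] unfolding switched_mult_nth by simp

text \<open>
  This is why switching preserves the Jordan structure although it destroys the associative
  one: path counts that change with the switching do so by an exchange of \<open>p\<close> and \<open>q\<close>.
\<close>

lemma switched_paths_symmetric_sum:
  "card (paths (switched_color i) UNIV p q x y) + card (paths (switched_color i) UNIV q p x y)
     = card (paths color UNIV p q x y) + card (paths color UNIV q p x y)"
proof -
  have diff: "2 * i - p - (2 * i - q) = q - p" for p q
    by simp
  have mixed: "card (paths color UNIV p (2 * i - q) x y) = card (paths color UNIV p q x y)"
    if "\<not> same_fiber x y" for x y p q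
  proof -
    have "real (card (paths color UNIV p (2 * i - q) x y)) = real (card (paths color UNIV p q x y))"
      unfolding card_paths_color using that by simp
    then show ?thesis by simp
  qed
  have rev: "card (paths color UNIV p q y x) = card (paths color UNIV q p x y)" for p q x y
    by (rule arg_cong[of _ _ card]) (use color_sym same_fiber_commute in \<open>auto simp: paths_def\<close>)
  show ?thesis
  proof (cases "x \<in> island"; cases "y \<in> island")
    assume isl: "x \<in> island" "y \<in> island"
    have flip: "card (paths color UNIV (2 * i - p) (2 * i - q) x y) = card (paths color UNIV q p x y)" for p q
    proof -
      have "real (card (paths color UNIV (2 * i - p) (2 * i - q) x y)) = real (card (paths color UNIV q p x y))"
        unfolding card_paths_color diff ..
      then show ?thesis by simp
    qed
    then show ?thesis
      using isl by (simp add: switched_paths_island)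
  next
    assume "x \<notin> island" "y \<notin> island"
    then show ?thesis
      by (simp add: card_switched_paths_continent card_paths_split[of color])
  next
    assume xy: "x \<notin> island" "y \<in> island"
    then have "\<not> same_fiber x y"
      using island_same_fiber(1) by blast
    then show ?thesis
      using xy by (simp add: switched_paths_mixed mixed)
  next
    assume xy: "x \<in> island" "y \<notin> island"
    then have "\<not> same_fiber y x"
      using island_same_fiber(1) by blast
    then have "card (paths (switched_color i) UNIV p q x y) = card (paths color UNIV p q x y)" for p q
      using xy mixed rev by (simp add: card_switched_paths_reverse[of i p q x y] switched_paths_mixed)
    then show ?thesis
      by simp
  qed
qed

section \<open>The Jordan scheme\<close>

lemma class_function_in_span:
  assumes "\<And>x y. M $ x $ y = (if same_fiber x y then if x = y then a else b else f (switched_color i x y))"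
  shows "M \<in> span (adjacency_matrix ` switched_graph R \<Delta> island i)"
proof (rule span_adjacencyI[OF partition_switched_graph])
  fix S assume "S \<in> switched_graph R \<Delta> island i"
  then consider "S = Id" | "S = R 1 \<union> R 2" | p where "S = switched_rel i p"
    unfolding switched_graph_eq by blast
  then show "\<exists>c. \<forall>x y. (x, y) \<in> S \<longrightarrow> M $ x $ y = c"
  proof cases
    case 1
    then show ?thesis
      by (intro exI[of _ a]) (auto simp: assms same_fiber_refl)
  next
    case 2
    then show ?thesis
      by (intro exI[of _ b]) (use R_1_2_iff in \<open>simp add: assms\<close>)
  next
    case (3 p)
    then show ?thesis
      by (intro exI[of _ "f p"]) (simp add: assms switched_rel_iff)
  qed
qed

lemma jordan_scheme_switched_graph: "jordan_scheme (switched_graph R \<Delta> island i)"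
proof -
  let ?J = "switched_graph R \<Delta> island i"
  let ?V = "span (adjacency_matrix ` ?J)"
  let ?E = "adjacency_matrix (R 1 \<union> R 2)"
  let ?D = "\<lambda>p. adjacency_matrix (switched_rel i p)"
  have in_J: "Id \<in> ?J" "R 1 \<union> R 2 \<in> ?J" "switched_rel i p \<in> ?J" for p
    by (simp_all add: switched_graph_eq)
  have one: "mat 1 \<in> ?V"
    using in_J(1) adjacency_matrix_Id by (metis span_base imageI)
  have gen: "adjacency_matrix S \<in> ?V" if "S \<in> ?J" for S
    using that by (simp add: span_base)
  have Id_any: "jordan_product (adjacency_matrix Id) A \<in> ?V" if "A \<in> ?V" for A
    using that by (simp add: jordan_product_def adjacency_matrix_Id scaleR_2[symmetric])
  \<comment> \<open>\<open>R 1\<close> and \<open>R 2\<close> are inverse to each other and \<open>R 1 R 1 = R 2\<close>, \<open>R 2 R 2 = R 1\<close>.\<close>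
  have E_E: "jordan_product ?E ?E \<in> ?V"
  proof -
    have "(1::3) + 1 = 2" "(1::3) + 2 = 0" "(2::3) + 1 = 0" "(2::3) + 2 = 1"
      by simp_all
    then have "?E ** ?E = ?E + 2 *\<^sub>R mat 1"
      by (simp only: adjacency_R_1_2 matrix_add_ldistrib matrix_add_rdistrib mult_R_R
          R_0 adjacency_matrix_Id scaleR_2 ac_simps)
    moreover have "jordan_product ?E ?E = ?E ** ?E"
      by (simp only: jordan_product_def scaleR_2[symmetric]) simp
    ultimately show ?thesis
      using one gen[OF in_J(2)] by (simp add: span_add span_scale)
  qed
  \<comment> \<open>The other two vertices in the fiber of \<open>x\<close> reach \<open>y\<close> with the two colors different from
    that of \<open>(x, y)\<close>.\<close>
  have E_D: "jordan_product ?E (?D p) \<in> ?V" for p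
  proof (rule class_function_in_span)
    have E_D_nth: "(?E ** ?D p) $ x $ y
        = (if same_fiber x y then 0 else if switched_color i x y = p then 0 else 1)" for x y
    proof -
      have "(?E ** ?D p) $ x $ y = ?D p $ shift 1 x $ y + ?D p $ shift 2 x $ y"
        by (simp add: adjacency_R_1_2 matrix_add_rdistrib R_mult_nth)
      also have "\<dots> = (if same_fiber x y then 0 else if switched_color i x y = p then 0 else 1)"
        using exhaust_Z3[of "switched_color i x y"] exhaust_Z3[of p]
        by (elim disjE) (simp_all add: adjacency_matrix_nth switched_rel_iff switched_color_shift_left)
      finally show ?thesis .
    qed
    have "(?D p ** ?E) $ x $ y = (?E ** ?D p) $ y $ x" for x y
      by (rule adjacency_matrix_mult_transpose) (rule sym_switched_rel sym_R_1_2)+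
    then show "jordan_product ?E (?D p) $ x $ y
        = (if same_fiber x y then if x = y then 0 else 0
           else (if switched_color i x y = p then 0 else 1))" for x y
      using switched_color_sym[of i x y] same_fiber_commute[of x y]
      by (simp add: jordan_product_def E_D_nth)
  qed
  have D_D: "jordan_product (?D p) (?D q) \<in> ?V" for p q
  proof (rule class_function_in_span)
    fix x y
    have "jordan_product (?D p) (?D q) $ x $ y
        = (real (card (paths color UNIV p q x y)) + real (card (paths color UNIV q p x y))) / 2"
      using arg_cong[OF switched_paths_symmetric_sum[of i p q x y], of real]
      by (simp add: jordan_product_def switched_mult_nth)
    also have "\<dots> = (if same_fiber x y
        then if x = y then if p = q then real m else 0 else if p = q then 0 else real m / 2
        else (real m - 1) / 3)"
    proof (cases "same_fiber x y")
      case True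
      then obtain t where t: "y = shift t x"
        by (auto simp: same_fiber_def)
      have "x = y \<longleftrightarrow> t = 0"
        using shift_inj_index[of 0 x t] by (auto simp: t shift_0)
      then show ?thesis
        using True Z3_opposite_differences[of p q t]
        by (auto simp: card_paths_color t shift_inj_index)
    next
      case False
      then show ?thesis
        by (simp add: card_paths_color)
    qed
    finally show "jordan_product (?D p) (?D q) $ x $ y = (if same_fiber x y
        then if x = y then if p = q then real m else 0 else if p = q then 0 else real m / 2
        else (real m - 1) / 3)" .
  qed
  have products: "jordan_product A B \<in> ?V"
    if A: "A \<in> adjacency_matrix ` ?J" and B: "B \<in> adjacency_matrix ` ?J" for A B
  proof -
    have gens: "A \<in> {adjacency_matrix Id, ?E} \<union> range ?D" "B \<in> {adjacency_matrix Id, ?E} \<union> range ?D"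
      using A B unfolding switched_graph_eq by auto
    have swap: "jordan_product A B \<in> ?V" if "jordan_product B A \<in> ?V" for A B
      using that by (subst jordan_product_commute)
    consider "A = adjacency_matrix Id" | "B = adjacency_matrix Id" | "A = ?E" "B = ?E"
      | p where "A = ?E" "B = ?D p" | p where "A = ?D p" "B = ?E"
      | p q where "A = ?D p" "B = ?D q"
      using gens by blast
    then show ?thesis
    proof cases
      case 1
      show ?thesis
        unfolding 1 by (rule Id_any) (rule span_base[OF B])
    next
      case 2
      show ?thesis
        unfolding 2 by (rule swap, rule Id_any) (rule span_base[OF A])
    next
      case 3
      show ?thesis
        unfolding 3 by (rule E_E)
    next
      case 4
      show ?thesis
        unfolding 4 by (rule E_D)
    next
      case 5
      show ?thesis
        unfolding 5 by (rule swap) (rule E_D)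
    next
      case 6
      show ?thesis
        unfolding 6 by (rule D_D)
    qed
  qed
  have "sym S" if "S \<in> ?J" for S
    using that sym_switched_rel sym_R_1_2 sym_Id unfolding switched_graph_eq by blast
  then show ?thesis
    unfolding jordan_scheme_def
    using partition_switched_graph in_J(1) jordan_product_span_closed[OF products] by blast
qed

section \<open>Properness\<close>

text \<open>
  A continental vertex \<open>x\<close> sees each color \<open>p\<close> exactly once on the island, and the color from
  there to \<open>shift t x\<close> is \<open>p - t\<close>.
\<close>

lemma card_island_paths_in_fiber:
  assumes "x \<notin> island"
  shows "card (paths color island p q x (shift t x)) = (if p - q = t then 1 else 0)"
proof -
  have sep: "\<not> same_fiber x z" "\<not> same_fiber z x" if "z \<in> island" for z
    using assms that island_same_fiber(1) by blast+
  obtain x0 where x0: "x0 \<in> island" "\<And>y. y \<in> island \<longleftrightarrow> same_fiber x0 y"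
    by (rule island_cases) blast
  have "paths color island p q x (shift t x) = {z \<in> island. color x z = p \<and> p - t = q}"
    using sep color_sym by (auto simp: paths_def color_shift_right)
  moreover have "{z \<in> island. color x z = p} = {shift (color x x0 - p) x0}"
    using sep[OF x0(1)] x0
    by (auto simp: same_fiber_def color_shift_right shift_inj_index)
  moreover have "p - t = q \<longleftrightarrow> p - q = t"
    by (auto simp: algebra_simps)
  ultimately show ?thesis
    by simp
qed

text \<open>
  Paths between island vertices run through the continent, so both steps are reflected and the
  entries are those of \<open>\<Delta> (2 * i - 1) \<Delta> (2 * i)\<close>, whose thin part is \<open>R (- 1) = R 2\<close>.
\<close>

lemma switched_product_on_island:
  assumes "x \<in> island"
  shows "(adjacency_matrix (switched_rel i 1) ** adjacency_matrix (switched_rel i 0)) $ x $ shift t x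
       = (if t = 2 then real m else 0)"
proof -
  have "2 * i - 1 - (2 * i - 0) = (2::3)" "- 1 = (2::3)"
    by simp_all
  then show ?thesis
    using assms by (auto simp: switched_mult_nth switched_paths_island card_paths_color same_fiber_refl
        shift_inj_index)
qed

text \<open>
  The thin part of \<open>\<Delta> 1 \<Delta> 0\<close> is \<open>R 1\<close>, with entry \<open>m\<close>. Only the single path through the island
  is affected by the switching, and it passes from \<open>shift 1 x\<close> to \<open>shift 2 x\<close>.
\<close>

lemma switched_product_on_continent:
  assumes "x \<notin> island" "t \<noteq> 0"
  shows "(adjacency_matrix (switched_rel i 1) ** adjacency_matrix (switched_rel i 0)) $ x $ shift t x
       = (if t = 1 then real m - 1 else 1)"
proof -
  let ?y = "shift t x"
  have "card (paths (switched_color i) UNIV 1 0 x ?y) + card (paths color island 1 0 x ?y)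
      = card (paths color UNIV 1 0 x ?y) + card (paths color island 0 1 x ?y)"
    using assms(1) by (simp add: card_switched_paths_continent card_paths_split[of color])
  then have "real (card (paths (switched_color i) UNIV 1 0 x ?y))
      = real (card (paths color UNIV 1 0 x ?y)) + real (card (paths color island 0 1 x ?y))
        - real (card (paths color island 1 0 x ?y))"
    by linarith
  then show ?thesis
    using assms exhaust_Z3[of t]
    by (auto simp: switched_mult_nth card_paths_color card_island_paths_in_fiber same_fiber_refl
        shift_inj_index)
qed

lemma switched_graph_not_symmetrization:
  assumes "association_scheme \<A>"
  shows "switched_graph R \<Delta> island i \<noteq> symmetrization \<A>"
proof
  assume eq: "switched_graph R \<Delta> island i = symmetrization \<A>"
  let ?N = "adjacency_matrix (switched_rel i 1) ** adjacency_matrix (switched_rel i 0)"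
  have "adjacency_matrix (switched_rel i p) \<in> span (adjacency_matrix ` \<A>)" for p
    using symmetrization_in_span[OF assms] by (simp add: eq[symmetric] switched_graph_eq)
  then have N: "?N \<in> span (adjacency_matrix ` \<A>)"
    using assms by (simp add: association_scheme_def)
  have "R 1 \<union> R 2 \<in> symmetrization \<A>"
    by (simp add: eq[symmetric] switched_graph_eq)
  then obtain S where S: "S \<in> \<A>" "R 1 \<union> R 2 = S \<union> S\<inverse>"
    by (auto simp: symmetrization_def)
  \<comment> \<open>The relation \<open>S\<close> contains \<open>R 1 \<union> R 2\<close> up to orientation, so it has an arc in every fiber,
    though its direction may vary from fiber to fiber.\<close>
  have arc: "\<exists>y t. (y, shift t y) \<in> S \<and> t \<noteq> 0 \<and> (y \<in> island \<longleftrightarrow> x \<in> island)" for x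
  proof -
    have "(x, shift 1 x) \<in> S \<or> (shift 1 x, x) \<in> S"
      using S(2) R_iff[of x "shift 1 x" 1] by blast
    moreover have "x = shift (- 1) (shift 1 x)"
      by (simp add: shift_shift shift_0)
    ultimately show ?thesis
      by (metis shift_island zero_neq_one neg_equal_0_iff_equal)
  qed
  obtain x0 where "x0 \<in> island"
    by (rule island_cases)
  then obtain x s where x: "x \<in> island" "(x, shift s x) \<in> S"
    using arc by blast
  obtain y0 where "y0 \<notin> island"
    by (rule continent_nonempty)
  then obtain y t where y: "y \<notin> island" "(y, shift t y) \<in> S" "t \<noteq> 0"
    using arc by blast
  have "?N $ x $ shift s x = ?N $ y $ shift t y"
    using assms by (intro span_adjacency_const_on_classes[OF _ N S(1) x(2) y(2)])
      (simp add: association_scheme_def)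
  then show False
    using x(1) y m_gt_1
    by (auto simp: switched_product_on_island switched_product_on_continent split: if_splits)
qed

section \<open>Isomorphism\<close>

lemma inj_shift_iff: "shift t x = shift t y \<longleftrightarrow> x = y"
  using shift_shift[of "- t" t] by (metis add.right_inverse shift_0)

lemma bij_shift: "bij (shift t)"
  by (rule bij_betw_byWitness[of _ "shift (- t)"]) (auto simp: shift_shift shift_0)

lemma shift_image_eq:
  assumes "\<And>x y. (shift t x, shift t y) \<in> T \<longleftrightarrow> (x, y) \<in> S"
  shows "map_prod (shift t) (shift t) ` S = T"
proof (intro equalityI subsetI)
  fix z assume "z \<in> T"
  then have "map_prod (shift (- t)) (shift (- t)) z \<in> S"
    using assms[of "shift (- t) (fst z)" "shift (- t) (snd z)"]
    by (cases z) (simp add: shift_shift shift_0)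
  then show "z \<in> map_prod (shift t) (shift t) ` S"
    by (rule rev_image_eqI) (cases z, simp add: shift_shift shift_0)
qed (auto simp: assms)

text \<open>
  Shifting both ends by \<open>t\<close> changes colors by \<open>- 2 * t = t\<close>, and the center \<open>i\<close> of the
  reflection has to move along.
\<close>

lemma shift_image_switched_rel:
  "map_prod (shift t) (shift t) ` switched_rel i p = switched_rel (i + t) (p + t)"
proof (rule shift_image_eq)
  have three: "c - t - t = c + t" for c :: 3
    using exhaust_Z3[of t] by (elim disjE) (simp_all add: algebra_simps)
  show "(shift t x, shift t y) \<in> switched_rel (i + t) (p + t) \<longleftrightarrow> (x, y) \<in> switched_rel i p" for x y
  proof (cases "same_fiber x y")
    case False
    then have "color (shift t x) (shift t y) = color x y + t"
      by (simp add: color_shift_left color_shift_right three)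
    then show ?thesis
      by (simp add: switched_rel_iff switched_color_def algebra_simps)
  qed (simp add: switched_rel_iff)
qed

lemma switched_graphs_isomorphic:
  "combinatorially_isomorphic (switched_graph R \<Delta> island i) (switched_graph R \<Delta> island j)"
proof -
  define t where "t = j - i"
  let ?f = "map_prod (shift t) (shift t)"
  have Id_image: "?f ` Id = Id"
    by (rule shift_image_eq) (simp add: inj_shift_iff)
  have E_image: "?f ` (R 1 \<union> R 2) = R 1 \<union> R 2"
    by (rule shift_image_eq) (simp only: R_1_2_iff same_fiber_shift_iff inj_shift_iff)
  have "(`) ?f ` range (switched_rel i) = range (switched_rel j)"
  proof -
    have "(`) ?f ` range (switched_rel i) = range (\<lambda>p. switched_rel j (p + t))"
      by (simp add: image_image shift_image_switched_rel t_def)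
    also have "\<dots> = range (switched_rel j)"
    proof (intro equalityI subsetI)
      fix S assume "S \<in> range (switched_rel j)"
      then obtain q where "S = switched_rel j (q - t + t)"
        by auto
      then show "S \<in> range (\<lambda>p. switched_rel j (p + t))"
        by (rule range_eqI)
    qed auto
    finally show ?thesis .
  qed
  then have "(`) ?f ` switched_graph R \<Delta> island i = switched_graph R \<Delta> island j"
    by (simp only: switched_graph_eq image_Un[of "(`) ?f"] image_insert image_empty Id_image E_image)
  then show ?thesis
    unfolding combinatorially_isomorphic_def using bij_shift by blast
qed

end
section \<open>The switched graphs are isomorphic proper Jordan schemes\<close>

theorem corollary16p5:
  fixes m :: nat
    and R \<Delta> :: "3 \<Rightarrow> 'a::finite rel"
    and island :: "'a set"
  assumes "m > 1" and "3 dvd (m - 1)"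
    and "CARD('a) = 3 * (m + 1)"
    and "association_scheme (range R \<union> range \<Delta>)"
    and "card (range R \<union> range \<Delta>) = 6"
    and "\<not> commutative_scheme (range R \<union> range \<Delta>)"
    and "R 0 = Id"
    and "\<And>i. has_valency (R i) 1"
    and "\<And>i. has_valency (\<Delta> i) m"
    and "\<And>i j. adjacency_matrix (R i) ** adjacency_matrix (R j) = adjacency_matrix (R (i + j))"
    and "\<And>i j. adjacency_matrix (R i) ** adjacency_matrix (\<Delta> j) = adjacency_matrix (\<Delta> (i + j))"
    and "\<And>i j. adjacency_matrix (\<Delta> j) ** adjacency_matrix (R i) = adjacency_matrix (\<Delta> (j - i))"
    and "\<And>i j. adjacency_matrix (\<Delta> i) ** adjacency_matrix (\<Delta> j) =
           real m *\<^sub>R adjacency_matrix (R (i - j)) +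
           ((real m - 1) / 3) *\<^sub>R
             (adjacency_matrix (\<Delta> 0) + adjacency_matrix (\<Delta> 1) + adjacency_matrix (\<Delta> 2))"
    and "island \<in> fibers R"
  shows "(\<forall>i. proper_jordan_scheme (switched_graph R \<Delta> island i) \<and>
              card (switched_graph R \<Delta> island i) = 5) \<and>
         (\<forall>i j. combinatorially_isomorphic
                  (switched_graph R \<Delta> island i) (switched_graph R \<Delta> island j))"
proof -
  interpret switching m R \<Delta> island
    using assms by unfold_locales (simp_all add: association_scheme_def)
  show ?thesis
    using jordan_scheme_switched_graph switched_graph_not_symmetrization card_switched_graph
      switched_graphs_isomorphic
    unfolding proper_jordan_scheme_def by blast
qed

end
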